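(* Let $(A,\succ,\prec,\Delta_\succ,\Delta_\prec)$ be a Leibniz-dendriform bialgebra, let $\{e_1,\dots,e_n\}$ be a basis of $A$ with dual basis $\{e_1^*,\dots,e_n^*\}$, and let $(D=A\oplus A^*,\succ_D,\prec_D)$ be its double Leibniz-dendriform algebra. Put $r=\sum_{i=1}^n e_i\otimes e_i^*\in A\otimes A^*\subseteq D\otimes D$. Then $r$ satisfies the Leibniz-dendriform Yang–Baxter equation $S(r)=0$ in $(D,\succ_D,\prec_D)$, $r+\tau(r)$ is invariant in $D$, and $T_{r+\tau(r)}:D^*\to D$ is a linear isomorphism. Consequently $(D,\succ_D,\prec_D,\Delta_{\succ,r},\Delta_{\prec,r})$ is a factorizable Leibniz-dendriform bialgebra.
   Context: All vector spaces are finite-dimensional over a field $k$; $\langle\cdot,\cdot\rangle$ is the natural pairing, $I$ the identity, $\tau(a\otimes b)=b\otimes a$. A Leibniz-dendriform algebra is a vector space $A$ with bilinear operations $\succ,\prec$ such that, with $x\circ y:=x\succ y+x\prec y$, for all $x,y,z$: $(x\circ y)\succ z=x\succ(y\succ z)-y\succ(x\succ z)$, $y\prec(x\circ z)+(x\succ y)\prec z=x\succ(y\prec z)$, $x\prec(y\circ z)=(x\prec y)\prec z+y\succ(x\prec z)$. Write $x\odot y:=x\succ y+y\prec x$, $x\star y:=x\circ y+y\circ x$; $L_*(x)y=x*y$, $R_*(x)y=y*x$; $L_\odot:=L_\succ+R_\prec$, $R_\odot:=R_\succ+L_\prec$, $L_\star:=L_\circ+R_\circ$; for a linear $f:A\to\mathrm{End}(V)$,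 $f^*:A\to\mathrm{End}(V^* )$ is $\langle f^*(x)\xi,v\rangle=-\langle\xi,f(x)v\rangle$. A Leibniz-dendriform bialgebra is $(A,\succ,\prec,\Delta_\succ,\Delta_\prec)$ with $(A,\succ,\prec)$ a Leibniz-dendriform algebra and linear $\Delta_\succ,\Delta_\prec:A\to A\otimes A$ such that, with $\Delta:=\Delta_\succ+\Delta_\prec$, $\Delta_\odot:=\Delta_\succ+\tau\Delta_\prec$: $(\Delta\otimes I)\Delta_\succ=(I\otimes\Delta_\succ)\Delta_\succ-(\tau\otimes I)(I\otimes\Delta_\succ)\Delta_\succ$; $(I\otimes\Delta_\prec)\Delta_\succ-(\Delta_\succ\otimes I)\Delta_\prec=(\tau\otimes I)(I\otimes\Delta)\Delta_\prec$; $(I\otimes\Delta)\Delta_\prec=(\Delta_\prec\otimes I)\Delta_\prec+(\tau\otimes I)(I\otimes\Delta_\prec)\Delta_\succ$; and for all $x,y$: (B1) $\Delta(x\odot y)-(I\otimes L_\odot(x))\Delta(y)+\tau(I\otimes L_\odot(x))\Delta(y)+\tau(I\otimes R_\odot(y))\Delta_\succ(x)-(I\otimes R_\odot(y))\Delta_\succ(x)=0$; (B2) $\Delta(x\succ y)-(L_\succ(x)\otimes I+I\otimes L_\succ(x))\Delta(y)-(I\otimes R_\succ(y))\Delta_\odot(x)+\tau(I\otimes R_\odot(y))\Delta_\odot(x)=0$; (B3) $(I\otimes R_\succ(y))\tau\Delta_\prec(x)-(R_\prec(x)\otimes I)\Delta(y)=0$; (B4) $(\Delta_\succ+\tau\Delta_\prec)(x\circ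 y)-(I\otimes L_\circ(x)+L_\succ(x)\otimes I)\Delta_\odot(y)+(I\otimes L_\circ(y)+L_\succ(y)\otimes I)\Delta_\odot(x)=0$; (B5) $\Delta_\succ(x\circ y)-(I\otimes R_\circ(y))\Delta_\succ(x)-(I\otimes L_\circ(x)+L_\odot(x)\otimes I)\Delta_\succ(y)+(L_\odot(y)\otimes I)\Delta_\odot(x)=0$; (B6) $(I\otimes R_\circ(y))\tau\Delta_\prec(x)-(R_\prec(x)\otimes I)\Delta_\succ(y)=0$. Dual operations: $\langle\zeta\succ_{A^*}\eta,x\rangle=\langle\zeta\otimes\eta,\Delta_\succ(x)\rangle$, $\langle\zeta\prec_{A^*}\eta,x\rangle=\langle\zeta\otimes\eta,\Delta_\prec(x)\rangle$, $\zeta\ast\eta=\zeta\succ_{A^*}\eta+\zeta\prec_{A^*}\eta$. Double operations on $D=A\oplus A^*$ ($x,y\in A$, $a,b\in A^*$): $(x+a)\succ_D(y+b)=x\succ y+L_\ast^*(a)y+(R_{\succ_{A^*}}^*+L_{\prec_{A^*}}^* )(b)x+a\succ_{A^*}b+L_\circ^*(x)b+(R_{\succ}^*+L_{\prec}^* )(y)a$, $(x+a)\prec_D(y+b)=x\prec y-L_{\prec_{A^*}}^*(a)y-(R_\ast^*+L_\ast^* )(b)x+a\prec_{A^*}b-L_{\prec}^*(x)b-(R_\circ^*+L_\circ^* )(y)a$; this is a Leibniz-dendriform algebra. For a Leibniz-dendriform algebra $B$ and $r=\sum_ia_i\otimes b_i\in B\otimes B$: $T_r:B^*\to B$, $\langle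 T_r(\zeta),\eta\rangle=\langle r,\zeta\otimes\eta\rangle$; $S(r):=\sum_{i,j}\big(a_i\otimes a_j\otimes (b_j\circ b_i)-a_i\otimes (b_i\odot a_j)\otimes b_j-(a_i\succ a_j)\otimes b_i\otimes b_j\big)$; $s\in B\otimes B$ is invariant if for all $x\in B$: $(L_\odot(x)\otimes I-I\otimes R_\circ(x))s=0$ and $(L_\star(x)\otimes I-I\otimes R_\prec(x))\tau(s)=0$. Coboundary maps: $\Delta_{\succ,r}(x)=(L_\odot(x)\otimes I-I\otimes R_\circ(x))r$, $\Delta_{\prec,r}(x)=(L_\star(x)\otimes I-I\otimes R_\prec(x))\tau(r)$. The coboundary bialgebra is factorizable if $S(r)=0$, $r+\tau(r)$ is invariant and $T_{r+\tau(r)}$ is a linear isomorphism. *)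

theory Defs
  imports Main
begin

text \<open>Coordinate model. A finite-dimensional space with basis indexed by a finite
type 'i is represented by its coordinate vectors 'i \<Rightarrow> 'k; the basis vector e_a is
bv a. Tensors in V\<otimes>V are functions 'i \<times> 'i \<Rightarrow> 'k (coefficients w.r.t. e_a\<otimes>e_b),
triple tensors are 'i \<times> 'i \<times> 'i \<Rightarrow> 'k. The dual space V* is represented w.r.t. the
dual basis, so the pairing is the sum of products of coordinates.\<close>

definition bv :: "'i \<Rightarrow> 'i \<Rightarrow> 'k::zero_neq_one" where
  "bv a = (\<lambda>i. if i = a then 1 else 0)"

definition mult_sc :: "('i \<Rightarrow> 'i \<Rightarrow> 'i \<Rightarrow> 'k) \<Rightarrow> ('i \<Rightarrow> 'k) \<Rightarrow> ('i \<Rightarrow> 'k) \<Rightarrow> ('i \<Rightarrow> 'k::comm_ring_1)" where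
  "mult_sc m x y = (\<lambda>l. \<Sum>i\<in>UNIV. \<Sum>j\<in>UNIV. x i * y j * m i j l)"

definition comult_sc :: "('i \<Rightarrow> 'i \<Rightarrow> 'i \<Rightarrow> 'k) \<Rightarrow> ('i \<Rightarrow> 'k) \<Rightarrow> ('i \<times> 'i \<Rightarrow> 'k::comm_ring_1)" where
  "comult_sc c x = (\<lambda>(i,j). \<Sum>l\<in>UNIV. x l * c l i j)"

definition dual_op :: "(('i \<Rightarrow> 'k) \<Rightarrow> ('i \<times> 'i \<Rightarrow> 'k)) \<Rightarrow> ('i \<Rightarrow> 'k) \<Rightarrow> ('i \<Rightarrow> 'k) \<Rightarrow> ('i \<Rightarrow> 'k::comm_ring_1)" where
  "dual_op Dl \<zeta> \<eta> = (\<lambda>l. \<Sum>i\<in>UNIV. \<Sum>j\<in>UNIV. \<zeta> i * \<eta> j * Dl (bv l) (i,j))"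

type_synonym ('i,'k) op = "('i \<Rightarrow> 'k) \<Rightarrow> ('i \<Rightarrow> 'k) \<Rightarrow> ('i \<Rightarrow> 'k)"

definition Lm :: "('i,'k) op \<Rightarrow> ('i \<Rightarrow> 'k) \<Rightarrow> ('i \<Rightarrow> 'k) \<Rightarrow> ('i \<Rightarrow> 'k)" where
  "Lm f x = (\<lambda>z. f x z)"
definition Rm :: "('i,'k) op \<Rightarrow> ('i \<Rightarrow> 'k) \<Rightarrow> ('i \<Rightarrow> 'k) \<Rightarrow> ('i \<Rightarrow> 'k)" where
  "Rm f y = (\<lambda>z. f z y)"

definition circ :: "('i,'k::comm_ring_1) op \<Rightarrow> ('i,'k) op \<Rightarrow> ('i,'k) op" where
  "circ s p x y = (\<lambda>i. s x y i + p x y i)"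
definition odot :: "('i,'k::comm_ring_1) op \<Rightarrow> ('i,'k) op \<Rightarrow> ('i,'k) op" where
  "odot s p x y = (\<lambda>i. s x y i + p y x i)"
definition starop :: "('i,'k::comm_ring_1) op \<Rightarrow> ('i,'k) op \<Rightarrow> ('i,'k) op" where
  "starop s p x y = (\<lambda>i. circ s p x y i + circ s p y x i)"

definition LD_algebra :: "('i,'k::comm_ring_1) op \<Rightarrow> ('i,'k) op \<Rightarrow> bool" where
  "LD_algebra s p \<longleftrightarrow> (\<forall>x y z.
      s (circ s p x y) z = (\<lambda>i. s x (s y z) i - s y (s x z) i) \<and>
      (\<lambda>i. p y (circ s p x z) i + p (s x y) z i) = s x (p y z) \<and>
      p x (circ s p y z) = (\<lambda>i. p (p x y) z i + s y (p x z) i))"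

definition tens2 :: "(('i \<Rightarrow> 'k) \<Rightarrow> ('i \<Rightarrow> 'k)) \<Rightarrow> (('i \<Rightarrow> 'k) \<Rightarrow> ('i \<Rightarrow> 'k)) \<Rightarrow> ('i \<times> 'i \<Rightarrow> 'k) \<Rightarrow> ('i \<times> 'i \<Rightarrow> 'k::comm_ring_1)" where
  "tens2 f g t = (\<lambda>(i,j). \<Sum>a\<in>UNIV. \<Sum>b\<in>UNIV. f (bv a) i * g (bv b) j * t (a,b))"

definition tau :: "('i \<times> 'i \<Rightarrow> 'k) \<Rightarrow> ('i \<times> 'i \<Rightarrow> 'k)" where
  "tau t = (\<lambda>(i,j). t (j,i))"

definition tpure :: "('i \<Rightarrow> 'k) \<Rightarrow> ('i \<Rightarrow> 'k) \<Rightarrow> ('i \<times> 'i \<Rightarrow> 'k::times)" where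
  "tpure x y = (\<lambda>(i,j). x i * y j)"

definition tpure3 :: "('i \<Rightarrow> 'k) \<Rightarrow> ('i \<Rightarrow> 'k) \<Rightarrow> ('i \<Rightarrow> 'k) \<Rightarrow> ('i \<times> 'i \<times> 'i \<Rightarrow> 'k::times)" where
  "tpure3 x y z = (\<lambda>(i,j,l). x i * y j * z l)"

definition coL :: "(('i \<Rightarrow> 'k) \<Rightarrow> ('i \<times> 'i \<Rightarrow> 'k)) \<Rightarrow> ('i \<times> 'i \<Rightarrow> 'k) \<Rightarrow> ('i \<times> 'i \<times> 'i \<Rightarrow> 'k::comm_ring_1)" where
  "coL Dl t = (\<lambda>(i,j,l). \<Sum>a\<in>UNIV. Dl (bv a) (i,j) * t (a,l))"
definition coR :: "(('i \<Rightarrow> 'k) \<Rightarrow> ('i \<times> 'i \<Rightarrow> 'k)) \<Rightarrow> ('i \<times> 'i \<Rightarrow> 'k) \<Rightarrow> ('i \<times> 'i \<times> 'i \<Rightarrow> 'k::comm_ring_1)" where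
  "coR Dl t = (\<lambda>(i,j,l). \<Sum>a\<in>UNIV. t (i,a) * Dl (bv a) (j,l))"
definition tau12 :: "('i \<times> 'i \<times> 'i \<Rightarrow> 'k) \<Rightarrow> ('i \<times> 'i \<times> 'i \<Rightarrow> 'k)" where
  "tau12 T = (\<lambda>(i,j,l). T (j,i,l))"

definition LD_bialgebra ::
  "('i,'k::comm_ring_1) op \<Rightarrow> ('i,'k) op \<Rightarrow> (('i \<Rightarrow> 'k) \<Rightarrow> ('i \<times> 'i \<Rightarrow> 'k)) \<Rightarrow> (('i \<Rightarrow> 'k) \<Rightarrow> ('i \<times> 'i \<Rightarrow> 'k)) \<Rightarrow> bool" where
  "LD_bialgebra s p Ds Dp \<longleftrightarrow> LD_algebra s p \<and>
    (let D = (\<lambda>x q. Ds x q + Dp x q);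
         Do = (\<lambda>x q. Ds x q + tau (Dp x) q);
         I = (\<lambda>z. z) in
     (\<forall>x.
       coL D (Ds x) = (\<lambda>w. coR Ds (Ds x) w - tau12 (coR Ds (Ds x)) w) \<and>
       (\<lambda>w. coR Dp (Ds x) w - coL Ds (Dp x) w) = tau12 (coR D (Dp x)) \<and>
       coR D (Dp x) = (\<lambda>w. coL Dp (Dp x) w + tau12 (coR Dp (Ds x)) w)) \<and>
     (\<forall>x y.
       (\<lambda>q. D (odot s p x y) q - tens2 I (Lm (odot s p) x) (D y) q
            + tau (tens2 I (Lm (odot s p) x) (D y)) q
            + tau (tens2 I (Rm (odot s p) y) (Ds x)) q
            - tens2 I (Rm (odot s p) y) (Ds x) q) = (\<lambda>q. 0) \<and>
       (\<lambda>q. D (s x y) q - tens2 (Lm s x) I (D y) q - tens2 I (Lm s x) (D y) q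
            - tens2 I (Rm s y) (Do x) q
            + tau (tens2 I (Rm (odot s p) y) (Do x)) q) = (\<lambda>q. 0) \<and>
       (\<lambda>q. tens2 I (Rm s y) (tau (Dp x)) q - tens2 (Rm p x) I (D y) q) = (\<lambda>q. 0) \<and>
       (\<lambda>q. Do (circ s p x y) q
            - tens2 I (Lm (circ s p) x) (Do y) q - tens2 (Lm s x) I (Do y) q
            + tens2 I (Lm (circ s p) y) (Do x) q + tens2 (Lm s y) I (Do x) q) = (\<lambda>q. 0) \<and>
       (\<lambda>q. Ds (circ s p x y) q - tens2 I (Rm (circ s p) y) (Ds x) q
            - tens2 I (Lm (circ s p) x) (Ds y) q - tens2 (Lm (odot s p) x) I (Ds y) q
            + tens2 (Lm (odot s p) y) I (Do x) q) = (\<lambda>q. 0) \<and>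
       (\<lambda>q. tens2 I (Rm (circ s p) y) (tau (Dp x)) q - tens2 (Rm p x) I (Ds y) q) = (\<lambda>q. 0)))"

definition dualrep :: "('j \<Rightarrow> ('i \<Rightarrow> 'k) \<Rightarrow> ('i \<Rightarrow> 'k)) \<Rightarrow> 'j \<Rightarrow> ('i \<Rightarrow> 'k) \<Rightarrow> ('i \<Rightarrow> 'k::comm_ring_1)" where
  "dualrep f x \<xi> = (\<lambda>i. - (\<Sum>j\<in>UNIV. \<xi> j * f x (bv i) j))"

text \<open>The double D = A \<oplus> A*: coordinates indexed by 'n + 'n, Inl = A, Inr = A*.
sA pA: operations of A; sS pS: the dual operations on A*.\<close>

definition double_succ :: "('n,'k::comm_ring_1) op \<Rightarrow> ('n,'k) op \<Rightarrow> ('n,'k) op \<Rightarrow> ('n,'k) op \<Rightarrow> ('n + 'n, 'k) op" where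
  "double_succ sA pA sS pS u v =
    (let x = (\<lambda>i. u (Inl i)); a = (\<lambda>i. u (Inr i)); y = (\<lambda>i. v (Inl i)); b = (\<lambda>i. v (Inr i));
         astar = circ sS pS; cA = circ sA pA in
     (\<lambda>w. case w of
        Inl i \<Rightarrow> sA x y i + dualrep (Lm astar) a y i + dualrep (Rm sS) b x i + dualrep (Lm pS) b x i
      | Inr i \<Rightarrow> sS a b i + dualrep (Lm cA) x b i + dualrep (Rm sA) y a i + dualrep (Lm pA) y a i))"

definition double_prec :: "('n,'k::comm_ring_1) op \<Rightarrow> ('n,'k) op \<Rightarrow> ('n,'k) op \<Rightarrow> ('n,'k) op \<Rightarrow> ('n + 'n, 'k) op" where
  "double_prec sA pA sS pS u v =
    (let x = (\<lambda>i. u (Inl i)); a = (\<lambda>i. u (Inr i)); y = (\<lambda>i. v (Inl i)); b = (\<lambda>i. v (Inr i));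
         astar = circ sS pS; cA = circ sA pA in
     (\<lambda>w. case w of
        Inl i \<Rightarrow> pA x y i - dualrep (Lm pS) a y i - dualrep (Rm astar) b x i - dualrep (Lm astar) b x i
      | Inr i \<Rightarrow> pS a b i - dualrep (Lm pA) x b i - dualrep (Rm cA) y a i - dualrep (Lm cA) y a i))"

definition r_can :: "('n::finite + 'n) \<times> ('n + 'n) \<Rightarrow> 'k::comm_ring_1" where
  "r_can = (\<lambda>q. \<Sum>i\<in>UNIV. tpure (bv (Inl i)) (bv (Inr i)) q)"

definition S_LD :: "('i,'k::comm_ring_1) op \<Rightarrow> ('i,'k) op \<Rightarrow> ('i \<times> 'i \<Rightarrow> 'k) \<Rightarrow> ('i \<times> 'i \<times> 'i \<Rightarrow> 'k)" where
  "S_LD s p r = (\<lambda>w. \<Sum>a\<in>UNIV. \<Sum>b\<in>UNIV. \<Sum>c\<in>UNIV. \<Sum>d\<in>UNIV.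
     r (a,b) * r (c,d) *
       (tpure3 (bv a) (bv c) (circ s p (bv d) (bv b)) w
        - tpure3 (bv a) (odot s p (bv b) (bv c)) (bv d) w
        - tpure3 (s (bv a) (bv c)) (bv b) (bv d) w))"

definition invariant_LD :: "('i,'k::comm_ring_1) op \<Rightarrow> ('i,'k) op \<Rightarrow> ('i \<times> 'i \<Rightarrow> 'k) \<Rightarrow> bool" where
  "invariant_LD s p t \<longleftrightarrow> (\<forall>x.
     (\<lambda>q. tens2 (Lm (odot s p) x) (\<lambda>z. z) t q - tens2 (\<lambda>z. z) (Rm (circ s p) x) t q) = (\<lambda>q. 0) \<and>
     (\<lambda>q. tens2 (Lm (starop s p) x) (\<lambda>z. z) (tau t) q - tens2 (\<lambda>z. z) (Rm p x) (tau t) q) = (\<lambda>q. 0))"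

definition T_map :: "('i \<times> 'i \<Rightarrow> 'k) \<Rightarrow> ('i \<Rightarrow> 'k) \<Rightarrow> ('i \<Rightarrow> 'k::comm_ring_1)" where
  "T_map r \<zeta> = (\<lambda>b. \<Sum>a\<in>UNIV. r (a,b) * \<zeta> a)"

definition cob_succ :: "('i,'k::comm_ring_1) op \<Rightarrow> ('i,'k) op \<Rightarrow> ('i \<times> 'i \<Rightarrow> 'k) \<Rightarrow> ('i \<Rightarrow> 'k) \<Rightarrow> ('i \<times> 'i \<Rightarrow> 'k)" where
  "cob_succ s p r x = (\<lambda>q. tens2 (Lm (odot s p) x) (\<lambda>z. z) r q - tens2 (\<lambda>z. z) (Rm (circ s p) x) r q)"

definition cob_prec :: "('i,'k::comm_ring_1) op \<Rightarrow> ('i,'k) op \<Rightarrow> ('i \<times> 'i \<Rightarrow> 'k) \<Rightarrow> ('i \<Rightarrow> 'k) \<Rightarrow> ('i \<times> 'i \<Rightarrow> 'k)" where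
  "cob_prec s p r x = (\<lambda>q. tens2 (Lm (starop s p) x) (\<lambda>z. z) (tau r) q - tens2 (\<lambda>z. z) (Rm p x) (tau r) q)"

definition factorizable_LD :: "('i,'k::comm_ring_1) op \<Rightarrow> ('i,'k) op \<Rightarrow> ('i \<times> 'i \<Rightarrow> 'k) \<Rightarrow> bool" where
  "factorizable_LD s p r \<longleftrightarrow>
     LD_bialgebra s p (cob_succ s p r) (cob_prec s p r) \<and>
     S_LD s p r = (\<lambda>w. 0) \<and>
     invariant_LD s p (\<lambda>q. r q + tau r q) \<and>
     bij (T_map (\<lambda>q. r q + tau r q))"

end

theory Submission
  imports Defs
begin

text \<open>
  The double D carries the symmetric form B pairing A with A*, and its operations are determined by
  the product x \<circ> y = x \<succ> y + x \<prec> y: with m(x,y,z) = B(x \<circ> y, z) one has B(x \<succ> y, z) = - m(x,z,y)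
  and B(x \<prec> y, z) = m(x,y,z) + m(x,z,y), where m(v,u,x) + m(v,x,u) = m(x,u,v) + m(u,x,v).
  Hence each axiom of D, paired with vectors through B, is a signed sum of instances of the
  left Leibniz identity for \<circ> with permuted arguments, and each instance of that identity with
  arguments in A or A* is a signed sum of the axioms of the given bialgebra.  The cooperations
  induced by r are dual, under B, to (a \<succ> b) - (x \<succ> y) and (a \<prec> b) - (x \<prec> y) for the A*-parts a, b and
  the A-parts x, y of the two arguments, so the axioms relating them to \<succ> and \<prec> reduce to the
  Leibniz identity as well, while r + \<tau>(r) is the inverse of B.
\<close>

subsection \<open>Axioms in terms of structure constants\<close>

type_synonym ('i, 'k) sconst = "'i \<Rightarrow> 'i \<Rightarrow> 'i \<Rightarrow> 'k"

definition lin :: "(('i::finite \<Rightarrow> 'k) \<Rightarrow> 'k::comm_ring_1) \<Rightarrow> bool" where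
  "lin F \<longleftrightarrow> (\<forall>x. F x = (\<Sum>i\<in>UNIV. x i * F (bv i)))"

lemma sum_bv_left [simp]:
  fixes f :: "'i::finite \<Rightarrow> 'k::comm_ring_1"
  shows "(\<Sum>i\<in>UNIV. bv a i * f i) = f a"
  by (simp add: bv_def if_distrib[of "\<lambda>z. z * _"] cong: if_cong)

lemma sum_bv_left' [simp]:
  fixes f :: "'i::finite \<Rightarrow> 'k::comm_ring_1"
  shows "(\<Sum>i\<in>UNIV. bv i a * f i) = f a"
  by (simp add: bv_def if_distrib[of "\<lambda>z. z * _"] cong: if_cong)

lemma lin_coord: "lin (\<lambda>x. x i)"
  by (simp add: lin_def bv_def if_distrib[of "\<lambda>z. _ * z"] cong: if_cong)

lemma linI: "(\<And>x. F x = (\<Sum>i\<in>UNIV. x i * F (bv i))) \<Longrightarrow> lin F"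
  unfolding lin_def by (rule allI)

lemma linD: "lin F \<Longrightarrow> F x = (\<Sum>i\<in>UNIV. x i * F (bv i))"
  unfolding lin_def by (erule spec)

lemma lin_add: "lin F \<Longrightarrow> lin G \<Longrightarrow> lin (\<lambda>x. F x + G x)"
  by (rule linI, subst linD[of F], assumption, subst linD[of G], assumption)
    (simp add: distrib_left sum.distrib)

lemma lin_diff: "lin F \<Longrightarrow> lin G \<Longrightarrow> lin (\<lambda>x. F x - G x)"
  by (rule linI, subst linD[of F], assumption, subst linD[of G], assumption)
    (simp add: right_diff_distrib sum_subtractf)

lemma lin_mult_const: "lin F \<Longrightarrow> lin (\<lambda>x. F x * c)"
  by (rule linI, subst linD[of F], assumption) (simp add: sum_distrib_right mult.assoc)

lemma lin_const_mult: "lin F \<Longrightarrow> lin (\<lambda>x. c * F x)"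
  using lin_mult_const[of F c] by (simp add: mult.commute)

lemma lin_sum:
  assumes "\<And>a. lin (F a)"
  shows "lin (\<lambda>x. \<Sum>a\<in>A. F a x)"
proof -
  have "(\<Sum>a\<in>A. F a x) = (\<Sum>i\<in>UNIV. x i * (\<Sum>a\<in>A. F a (bv i)))" for x
  proof -
    have "(\<Sum>a\<in>A. F a x) = (\<Sum>a\<in>A. \<Sum>i\<in>UNIV. x i * F a (bv i))"
      using linD[OF assms] by (intro sum.cong refl)
    also have "\<dots> = (\<Sum>i\<in>UNIV. x i * (\<Sum>a\<in>A. F a (bv i)))"
      by (subst sum.swap) (simp add: sum_distrib_left)
    finally show ?thesis .
  qed
  then show ?thesis by (rule linI)
qed

lemmas lin_intros = lin_coord lin_add lin_diff lin_sum lin_mult_const lin_const_mult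

lemma lin_zero_iff: "lin F \<Longrightarrow> (\<forall>x. F x = 0) \<longleftrightarrow> (\<forall>i. F (bv i) = 0)"
  by (metis (no_types, lifting) linD mult_zero_right sum.neutral)

lemma bilin_zero_iff:
  assumes "\<And>y. lin (\<lambda>x. F x y)" "\<And>x. lin (F x)"
  shows "(\<forall>x y. F x y = 0) \<longleftrightarrow> (\<forall>i j. F (bv i) (bv j) = 0)"
  using lin_zero_iff[OF assms(1)] lin_zero_iff[OF assms(2)] by blast

lemma trilin_zero_iff:
  assumes "\<And>y z. lin (\<lambda>x. F x y z)" "\<And>x z. lin (\<lambda>y. F x y z)" "\<And>x y. lin (F x y)"
  shows "(\<forall>x y z. F x y z = 0) \<longleftrightarrow> (\<forall>i j k. F (bv i) (bv j) (bv k) = 0)"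
proof
  assume *: "\<forall>i j k. F (bv i) (bv j) (bv k) = 0"
  have "F (bv i) y z = 0" for i y z
    using bilin_zero_iff[of "F (bv i)"] assms * by blast
  then show "\<forall>x y z. F x y z = 0"
    using lin_zero_iff[OF assms(1)] by blast
qed auto

lemma mult_sc_bv_left: "mult_sc m (bv i) y l = (\<Sum>j\<in>UNIV. y j * m i j l)"
  for i :: "'i::finite"
  by (simp add: mult_sc_def mult.assoc sum_distrib_left[symmetric])

lemma mult_sc_bv_right: "mult_sc m x (bv j) l = (\<Sum>i\<in>UNIV. x i * m i j l)"
  for j :: "'i::finite"
  by (simp add: mult_sc_def mult.assoc sum_distrib_left[symmetric])

lemma mult_sc_bv [simp]: "mult_sc m (bv i) (bv j) l = m i j l" for i :: "'i::finite"
  by (simp add: mult_sc_bv_left)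

lemma comult_sc_bv [simp]: "comult_sc c (bv a) (i, j) = c a i j" for a :: "'i::finite"
  by (simp add: comult_sc_def)

lemma comult_sc_mult_sc_bv:
  "comult_sc c (mult_sc m (bv i) (bv j)) (u, v) = (\<Sum>l\<in>UNIV. m i j l * c l u v)" for i :: "'i::finite"
  by (simp add: comult_sc_def)

lemma circ_mult_sc: "circ (mult_sc s) (mult_sc p) = mult_sc (\<lambda>i j l. s i j l + p i j l)"
  by (simp add: fun_eq_iff circ_def mult_sc_def sum.distrib[symmetric] algebra_simps)

lemma odot_mult_sc: "odot (mult_sc s) (mult_sc p) = mult_sc (\<lambda>i j l. s i j l + p j i l)"
proof -
  have "mult_sc p y x l = mult_sc (\<lambda>i j. p j i) x y l" for x y l
    unfolding mult_sc_def by (subst sum.swap) (simp add: mult.commute)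
  then show ?thesis
    by (simp add: fun_eq_iff odot_def) (simp add: mult_sc_def sum.distrib[symmetric] algebra_simps)
qed

lemma starop_mult_sc:
  "starop (mult_sc s) (mult_sc p) = mult_sc (\<lambda>i j l. s i j l + p i j l + (s j i l + p j i l))"
proof -
  have "starop (mult_sc s) (mult_sc p) = odot (circ (mult_sc s) (mult_sc p)) (circ (mult_sc s) (mult_sc p))"
    by (simp add: fun_eq_iff starop_def odot_def)
  then show ?thesis
    by (simp add: circ_mult_sc odot_mult_sc)
qed

lemma comult_sc_add: "comult_sc c x q + comult_sc d x q = comult_sc (\<lambda>l i j. c l i j + d l i j) x q"
  by (cases q) (simp add: comult_sc_def sum.distrib[symmetric] algebra_simps)

lemma tau_comult_sc: "tau (comult_sc c x) = comult_sc (\<lambda>l i j. c l j i) x"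
  by (simp add: fun_eq_iff tau_def comult_sc_def)

lemma tens2_id_left [simp]: "tens2 (\<lambda>z. z) g t (i, j) = (\<Sum>b\<in>UNIV. g (bv b) j * t (i, b))"
  for i :: "'i::finite"
  by (simp add: tens2_def mult.assoc sum_distrib_left[symmetric])

lemma tens2_id_right [simp]: "tens2 f (\<lambda>z. z) t (i, j) = (\<Sum>a\<in>UNIV. f (bv a) i * t (a, j))"
  for i :: "'i::finite"
  by (simp add: tens2_def mult.assoc sum_distrib_left[symmetric])

definition ld_ax1 :: "('i::finite, 'k::comm_ring_1) sconst \<Rightarrow> ('i, 'k) sconst
    \<Rightarrow> 'i \<Rightarrow> 'i \<Rightarrow> 'i \<Rightarrow> 'i \<Rightarrow> 'k" where
  "ld_ax1 s p x y z w =
    (\<Sum>e\<in>UNIV. (s x y e + p x y e) * s e z w - s y z e * s x e w + s x z e * s y e w)"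

definition ld_ax2 :: "('i::finite, 'k::comm_ring_1) sconst \<Rightarrow> ('i, 'k) sconst
    \<Rightarrow> 'i \<Rightarrow> 'i \<Rightarrow> 'i \<Rightarrow> 'i \<Rightarrow> 'k" where
  "ld_ax2 s p x y z w =
    (\<Sum>e\<in>UNIV. (s x z e + p x z e) * p y e w + s x y e * p e z w - p y z e * s x e w)"

definition ld_ax3 :: "('i::finite, 'k::comm_ring_1) sconst \<Rightarrow> ('i, 'k) sconst
    \<Rightarrow> 'i \<Rightarrow> 'i \<Rightarrow> 'i \<Rightarrow> 'i \<Rightarrow> 'k" where
  "ld_ax3 s p x y z w =
    (\<Sum>e\<in>UNIV. (s y z e + p y z e) * p x e w - p x y e * p e z w - p x z e * s y e w)"

definition LD_sc :: "('i::finite, 'k::comm_ring_1) sconst \<Rightarrow> ('i, 'k) sconst \<Rightarrow> bool" where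
  "LD_sc s p \<longleftrightarrow> (\<forall>x y z w. ld_ax1 s p x y z w = 0 \<and> ld_ax2 s p x y z w = 0 \<and> ld_ax3 s p x y z w = 0)"

lemma LD_algebra_mult_sc: "LD_algebra (mult_sc s) (mult_sc p) \<longleftrightarrow> LD_sc s p"
proof -
  let ?s = "mult_sc s" and ?p = "mult_sc p"
  have 1: "(\<forall>x y z. ?s (circ ?s ?p x y) z w - (?s x (?s y z) w - ?s y (?s x z) w) = 0) \<longleftrightarrow>
     (\<forall>x y z. ld_ax1 s p x y z w = 0)" for w
    unfolding circ_mult_sc ld_ax1_def
    by (subst trilin_zero_iff, simp_all only: mult_sc_bv_left mult_sc_bv_right mult_sc_bv, unfold mult_sc_def)
      ((intro lin_intros)+, simp add: sum.distrib sum_subtractf algebra_simps)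
  have 2: "(\<forall>x y z. ?p y (circ ?s ?p x z) w + ?p (?s x y) z w - ?s x (?p y z) w = 0) \<longleftrightarrow>
     (\<forall>x y z. ld_ax2 s p x y z w = 0)" for w
    unfolding circ_mult_sc ld_ax2_def
    by (subst trilin_zero_iff, simp_all only: mult_sc_bv_left mult_sc_bv_right mult_sc_bv, unfold mult_sc_def)
      ((intro lin_intros)+, simp add: sum.distrib sum_subtractf algebra_simps)
  have 3: "(\<forall>x y z. ?p x (circ ?s ?p y z) w - (?p (?p x y) z w + ?s y (?p x z) w) = 0) \<longleftrightarrow>
     (\<forall>x y z. ld_ax3 s p x y z w = 0)" for w
    unfolding circ_mult_sc ld_ax3_def
    by (subst trilin_zero_iff, simp_all only: mult_sc_bv_left mult_sc_bv_right mult_sc_bv, unfold mult_sc_def)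
      ((intro lin_intros)+, simp add: sum.distrib sum_subtractf algebra_simps)
  have "LD_algebra ?s ?p \<longleftrightarrow>
    (\<forall>w x y z. ?s (circ ?s ?p x y) z w - (?s x (?s y z) w - ?s y (?s x z) w) = 0) \<and>
    (\<forall>w x y z. ?p y (circ ?s ?p x z) w + ?p (?s x y) z w - ?s x (?p y z) w = 0) \<and>
    (\<forall>w x y z. ?p x (circ ?s ?p y z) w - (?p (?p x y) z w + ?s y (?p x z) w) = 0)"
    unfolding LD_algebra_def fun_eq_iff right_minus_eq by blast
  then show ?thesis
    unfolding 1 2 3 LD_sc_def by blast
qed

definition co_ax1 :: "('i::finite, 'k::comm_ring_1) sconst \<Rightarrow> ('i, 'k) sconst
    \<Rightarrow> 'i \<Rightarrow> 'i \<Rightarrow> 'i \<Rightarrow> 'i \<Rightarrow> 'k" where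
  "co_ax1 S P x i j l =
    (\<Sum>e\<in>UNIV. (S e i j + P e i j) * S x e l - S x i e * S e j l + S x j e * S e i l)"

definition co_ax2 :: "('i::finite, 'k::comm_ring_1) sconst \<Rightarrow> ('i, 'k) sconst
    \<Rightarrow> 'i \<Rightarrow> 'i \<Rightarrow> 'i \<Rightarrow> 'i \<Rightarrow> 'k" where
  "co_ax2 S P x i j l =
    (\<Sum>e\<in>UNIV. S x i e * P e j l - S e i j * P x e l - P x j e * (S e i l + P e i l))"

definition co_ax3 :: "('i::finite, 'k::comm_ring_1) sconst \<Rightarrow> ('i, 'k) sconst
    \<Rightarrow> 'i \<Rightarrow> 'i \<Rightarrow> 'i \<Rightarrow> 'i \<Rightarrow> 'k" where
  "co_ax3 S P x i j l =
    (\<Sum>e\<in>UNIV. P x i e * (S e j l + P e j l) - P e i j * P x e l - S x j e * P e i l)"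

definition LDco_sc :: "('i::finite, 'k::comm_ring_1) sconst \<Rightarrow> ('i, 'k) sconst \<Rightarrow> bool" where
  "LDco_sc S P \<longleftrightarrow> (\<forall>x i j l. co_ax1 S P x i j l = 0 \<and> co_ax2 S P x i j l = 0 \<and> co_ax3 S P x i j l = 0)"

definition bi_ax1 ::
  "('i::finite, 'k::comm_ring_1) sconst \<Rightarrow> ('i, 'k) sconst \<Rightarrow> ('i, 'k) sconst \<Rightarrow> ('i, 'k) sconst
    \<Rightarrow> 'i \<Rightarrow> 'i \<Rightarrow> 'i \<Rightarrow> 'i \<Rightarrow> 'k" where
  "bi_ax1 s p S P x y u v =
    (\<Sum>e\<in>UNIV. (s x y e + p y x e) * (S e u v + P e u v) - (s x e v + p e x v) * (S y u e + P y u e)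
        + (s x e u + p e x u) * (S y v e + P y v e) + (s e y u + p y e u) * S x v e
        - (s e y v + p y e v) * S x u e)"

definition bi_ax2 ::
  "('i::finite, 'k::comm_ring_1) sconst \<Rightarrow> ('i, 'k) sconst \<Rightarrow> ('i, 'k) sconst \<Rightarrow> ('i, 'k) sconst
    \<Rightarrow> 'i \<Rightarrow> 'i \<Rightarrow> 'i \<Rightarrow> 'i \<Rightarrow> 'k" where
  "bi_ax2 s p S P x y u v =
    (\<Sum>e\<in>UNIV. s x y e * (S e u v + P e u v) - s x e u * (S y e v + P y e v) - s x e v * (S y u e + P y u e)
        - s e y v * (S x u e + P x e u) + (s e y u + p y e u) * (S x v e + P x e v))"

definition bi_ax3 ::
  "('i::finite, 'k::comm_ring_1) sconst \<Rightarrow> ('i, 'k) sconst \<Rightarrow> ('i, 'k) sconst \<Rightarrow> ('i, 'k) sconst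
    \<Rightarrow> 'i \<Rightarrow> 'i \<Rightarrow> 'i \<Rightarrow> 'i \<Rightarrow> 'k" where
  "bi_ax3 s p S P x y u v =
    (\<Sum>e\<in>UNIV. s e y v * P x e u - p e x u * (S y e v + P y e v))"

definition bi_ax4 ::
  "('i::finite, 'k::comm_ring_1) sconst \<Rightarrow> ('i, 'k) sconst \<Rightarrow> ('i, 'k) sconst \<Rightarrow> ('i, 'k) sconst
    \<Rightarrow> 'i \<Rightarrow> 'i \<Rightarrow> 'i \<Rightarrow> 'i \<Rightarrow> 'k" where
  "bi_ax4 s p S P x y u v =
    (\<Sum>e\<in>UNIV. (s x y e + p x y e) * (S e u v + P e v u) - (s x e v + p x e v) * (S y u e + P y e u)
        - s x e u * (S y e v + P y v e) + (s y e v + p y e v) * (S x u e + P x e u)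
        + s y e u * (S x e v + P x v e))"

definition bi_ax5 ::
  "('i::finite, 'k::comm_ring_1) sconst \<Rightarrow> ('i, 'k) sconst \<Rightarrow> ('i, 'k) sconst \<Rightarrow> ('i, 'k) sconst
    \<Rightarrow> 'i \<Rightarrow> 'i \<Rightarrow> 'i \<Rightarrow> 'i \<Rightarrow> 'k" where
  "bi_ax5 s p S P x y u v =
    (\<Sum>e\<in>UNIV. (s x y e + p x y e) * S e u v - (s e y v + p e y v) * S x u e - (s x e v + p x e v) * S y u e
        - (s x e u + p e x u) * S y e v + (s y e u + p e y u) * (S x e v + P x v e))"

definition bi_ax6 ::
  "('i::finite, 'k::comm_ring_1) sconst \<Rightarrow> ('i, 'k) sconst \<Rightarrow> ('i, 'k) sconst \<Rightarrow> ('i, 'k) sconst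
    \<Rightarrow> 'i \<Rightarrow> 'i \<Rightarrow> 'i \<Rightarrow> 'i \<Rightarrow> 'k" where
  "bi_ax6 s p S P x y u v =
    (\<Sum>e\<in>UNIV. (s e y v + p e y v) * P x e u - p e x u * S y e v)"

definition LDbi_sc ::
  "('i::finite, 'k::comm_ring_1) sconst \<Rightarrow> ('i, 'k) sconst \<Rightarrow> ('i, 'k) sconst \<Rightarrow> ('i, 'k) sconst \<Rightarrow> bool" where
  "LDbi_sc s p S P \<longleftrightarrow> (\<forall>x y u v.
     bi_ax1 s p S P x y u v = 0 \<and> bi_ax2 s p S P x y u v = 0 \<and> bi_ax3 s p S P x y u v = 0 \<and>
     bi_ax4 s p S P x y u v = 0 \<and> bi_ax5 s p S P x y u v = 0 \<and> bi_ax6 s p S P x y u v = 0)"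

lemma LD_coalgebra_comult_sc:
  fixes S P :: "'i::finite \<Rightarrow> 'i \<Rightarrow> 'i \<Rightarrow> 'k::comm_ring_1"
  defines "D \<equiv> comult_sc (\<lambda>l i j. S l i j + P l i j)"
  shows "(\<forall>x.
       coL D (comult_sc S x) = (\<lambda>w. coR (comult_sc S) (comult_sc S x) w - tau12 (coR (comult_sc S) (comult_sc S x)) w) \<and>
       (\<lambda>w. coR (comult_sc P) (comult_sc S x) w - coL (comult_sc S) (comult_sc P x) w) = tau12 (coR D (comult_sc P x)) \<and>
       coR D (comult_sc P x) = (\<lambda>w. coL (comult_sc P) (comult_sc P x) w + tau12 (coR (comult_sc P) (comult_sc S x)) w))
     \<longleftrightarrow> LDco_sc S P"
proof -
  have *: "\<And>x i j l. coL (comult_sc c) (comult_sc d x) (i, j, l) = (\<Sum>e\<in>UNIV. c e i j * comult_sc d x (e, l))"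
    "\<And>x i j l. coR (comult_sc c) (comult_sc d x) (i, j, l) = (\<Sum>e\<in>UNIV. c e j l * comult_sc d x (i, e))"
    for c d :: "'i \<Rightarrow> 'i \<Rightarrow> 'i \<Rightarrow> 'k"
    by (simp_all add: coL_def coR_def mult.commute)
  let ?S = "comult_sc S" and ?P = "comult_sc P" and ?D = "comult_sc (\<lambda>l i j. S l i j + P l i j)"
  have 1: "(\<forall>x. coL ?D (?S x) (i, j, l) - (coR ?S (?S x) (i, j, l) - tau12 (coR ?S (?S x)) (i, j, l)) = 0)
     \<longleftrightarrow> (\<forall>x. co_ax1 S P x i j l = 0)" for i j l
    unfolding tau12_def prod.case * co_ax1_def
    by (subst lin_zero_iff, simp_all only: comult_sc_bv, unfold comult_sc_def prod.case)
      ((intro lin_intros)+, simp add: sum.distrib sum_subtractf algebra_simps)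
  have 2: "(\<forall>x. coR ?P (?S x) (i, j, l) - coL ?S (?P x) (i, j, l) - tau12 (coR ?D (?P x)) (i, j, l) = 0)
     \<longleftrightarrow> (\<forall>x. co_ax2 S P x i j l = 0)" for i j l
    unfolding tau12_def prod.case * co_ax2_def
    by (subst lin_zero_iff, simp_all only: comult_sc_bv, unfold comult_sc_def prod.case)
      ((intro lin_intros)+, simp add: sum.distrib sum_subtractf algebra_simps)
  have 3: "(\<forall>x. coR ?D (?P x) (i, j, l) - (coL ?P (?P x) (i, j, l) + tau12 (coR ?P (?S x)) (i, j, l)) = 0)
     \<longleftrightarrow> (\<forall>x. co_ax3 S P x i j l = 0)" for i j l
    unfolding tau12_def prod.case * co_ax3_def
    by (subst lin_zero_iff, simp_all only: comult_sc_bv, unfold comult_sc_def prod.case)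
      ((intro lin_intros)+, simp add: sum.distrib sum_subtractf algebra_simps)
  have "?thesis \<longleftrightarrow> (((\<forall>i j l. \<forall>x. coL ?D (?S x) (i, j, l) - (coR ?S (?S x) (i, j, l) - tau12 (coR ?S (?S x)) (i, j, l)) = 0) \<and>
     (\<forall>i j l. \<forall>x. coR ?P (?S x) (i, j, l) - coL ?S (?P x) (i, j, l) - tau12 (coR ?D (?P x)) (i, j, l) = 0) \<and>
     (\<forall>i j l. \<forall>x. coR ?D (?P x) (i, j, l) - (coL ?P (?P x) (i, j, l) + tau12 (coR ?P (?S x)) (i, j, l)) = 0))
     \<longleftrightarrow> LDco_sc S P)"
    unfolding fun_eq_iff split_paired_All right_minus_eq D_def by (intro arg_cong2[where f = "(=)"] refl) blast
  then show ?thesis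
    unfolding 1 2 3 LDco_sc_def by blast
qed

lemma LD_bialgebra_sc:
  fixes s p S P :: "'i::finite \<Rightarrow> 'i \<Rightarrow> 'i \<Rightarrow> 'k::comm_ring_1"
  shows "LD_bialgebra (mult_sc s) (mult_sc p) (comult_sc S) (comult_sc P) \<longleftrightarrow>
    LD_sc s p \<and> LDco_sc S P \<and> LDbi_sc s p S P"
proof -
  let ?s = "mult_sc s" and ?p = "mult_sc p" and ?I = "\<lambda>z::'i \<Rightarrow> 'k. z"
  let ?c = "mult_sc (\<lambda>i j l. s i j l + p i j l)" and ?o = "mult_sc (\<lambda>i j l. s i j l + p j i l)"
  let ?S = "comult_sc S" and ?P = "comult_sc P" and ?D = "comult_sc (\<lambda>l i j. S l i j + P l i j)"
    and ?E = "comult_sc (\<lambda>l i j. S l i j + P l j i)" and ?Q = "comult_sc (\<lambda>l i j. P l j i)"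
  note coords = tau_def prod.case tens2_id_left tens2_id_right Lm_def Rm_def
  have 1: "(\<forall>x y. ?D (?o x y) (u, v)
        - tens2 ?I (Lm ?o x) (?D y) (u, v)
            + tau (tens2 ?I (Lm ?o x) (?D y)) (u, v)
            + tau (tens2 ?I (Rm ?o y) (?S x)) (u, v)
            - tens2 ?I (Rm ?o y) (?S x) (u, v) = 0) \<longleftrightarrow>
      (\<forall>x y. bi_ax1 s p S P x y u v = 0)" for u v
    unfolding coords bi_ax1_def
    by (subst bilin_zero_iff, simp_all only: mult_sc_bv_left mult_sc_bv_right comult_sc_bv
        comult_sc_mult_sc_bv, unfold mult_sc_def comult_sc_def prod.case)
      ((intro lin_intros)+, simp add: sum.distrib sum_subtractf algebra_simps)
  have 2: "(\<forall>x y. ?D (?s x y) (u, v)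
        - tens2 (Lm ?s x) ?I (?D y) (u, v)
        - tens2 ?I (Lm ?s x) (?D y) (u, v)
        - tens2 ?I (Rm ?s y) (?E x) (u, v)
        + tau (tens2 ?I (Rm ?o y) (?E x)) (u, v) = 0) \<longleftrightarrow>
      (\<forall>x y. bi_ax2 s p S P x y u v = 0)" for u v
    unfolding coords bi_ax2_def
    by (subst bilin_zero_iff, simp_all only: mult_sc_bv_left mult_sc_bv_right comult_sc_bv
        comult_sc_mult_sc_bv, unfold mult_sc_def comult_sc_def prod.case)
      ((intro lin_intros)+, simp add: sum.distrib sum_subtractf algebra_simps)
  have 3: "(\<forall>x y. tens2 ?I (Rm ?s y) (?Q x) (u, v)
        - tens2 (Rm ?p x) ?I (?D y) (u, v) = 0) \<longleftrightarrow>
      (\<forall>x y. bi_ax3 s p S P x y u v = 0)" for u v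
    unfolding coords bi_ax3_def
    by (subst bilin_zero_iff, simp_all only: mult_sc_bv_left mult_sc_bv_right comult_sc_bv
        comult_sc_mult_sc_bv, unfold mult_sc_def comult_sc_def prod.case)
      ((intro lin_intros)+, simp add: sum.distrib sum_subtractf algebra_simps)
  have 4: "(\<forall>x y. ?E (?c x y) (u, v)
        - tens2 ?I (Lm ?c x) (?E y) (u, v)
        - tens2 (Lm ?s x) ?I (?E y) (u, v)
        + tens2 ?I (Lm ?c y) (?E x) (u, v)
        + tens2 (Lm ?s y) ?I (?E x) (u, v) = 0) \<longleftrightarrow>
      (\<forall>x y. bi_ax4 s p S P x y u v = 0)" for u v
    unfolding coords bi_ax4_def
    by (subst bilin_zero_iff, simp_all only: mult_sc_bv_left mult_sc_bv_right comult_sc_bv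
        comult_sc_mult_sc_bv, unfold mult_sc_def comult_sc_def prod.case)
      ((intro lin_intros)+, simp add: sum.distrib sum_subtractf algebra_simps)
  have 5: "(\<forall>x y. ?S (?c x y) (u, v)
        - tens2 ?I (Rm ?c y) (?S x) (u, v)
        - tens2 ?I (Lm ?c x) (?S y) (u, v)
        - tens2 (Lm ?o x) ?I (?S y) (u, v)
        + tens2 (Lm ?o y) ?I (?E x) (u, v) = 0) \<longleftrightarrow>
      (\<forall>x y. bi_ax5 s p S P x y u v = 0)" for u v
    unfolding coords bi_ax5_def
    by (subst bilin_zero_iff, simp_all only: mult_sc_bv_left mult_sc_bv_right comult_sc_bv
        comult_sc_mult_sc_bv, unfold mult_sc_def comult_sc_def prod.case)
      ((intro lin_intros)+, simp add: sum.distrib sum_subtractf algebra_simps)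
  have 6: "(\<forall>x y. tens2 ?I (Rm ?c y) (?Q x) (u, v)
        - tens2 (Rm ?p x) ?I (?S y) (u, v) = 0) \<longleftrightarrow>
      (\<forall>x y. bi_ax6 s p S P x y u v = 0)" for u v
    unfolding coords bi_ax6_def
    by (subst bilin_zero_iff, simp_all only: mult_sc_bv_left mult_sc_bv_right comult_sc_bv
        comult_sc_mult_sc_bv, unfold mult_sc_def comult_sc_def prod.case)
      ((intro lin_intros)+, simp add: sum.distrib sum_subtractf algebra_simps)
  have "LD_bialgebra ?s ?p ?S ?P \<longleftrightarrow> LD_algebra ?s ?p \<and> LDco_sc S P \<and>
    (\<forall>u v. \<forall>x y. ?D (?o x y) (u, v)
        - tens2 ?I (Lm ?o x) (?D y) (u, v)
        + tau (tens2 ?I (Lm ?o x) (?D y)) (u, v)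
        + tau (tens2 ?I (Rm ?o y) (?S x)) (u, v)
        - tens2 ?I (Rm ?o y) (?S x) (u, v) = 0) \<and>
    (\<forall>u v. \<forall>x y. ?D (?s x y) (u, v)
        - tens2 (Lm ?s x) ?I (?D y) (u, v)
        - tens2 ?I (Lm ?s x) (?D y) (u, v)
        - tens2 ?I (Rm ?s y) (?E x) (u, v)
        + tau (tens2 ?I (Rm ?o y) (?E x)) (u, v) = 0) \<and>
    (\<forall>u v. \<forall>x y. tens2 ?I (Rm ?s y) (?Q x) (u, v)
        - tens2 (Rm ?p x) ?I (?D y) (u, v) = 0) \<and>
    (\<forall>u v. \<forall>x y. ?E (?c x y) (u, v)
        - tens2 ?I (Lm ?c x) (?E y) (u, v)
        - tens2 (Lm ?s x) ?I (?E y) (u, v)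
        + tens2 ?I (Lm ?c y) (?E x) (u, v)
        + tens2 (Lm ?s y) ?I (?E x) (u, v) = 0) \<and>
    (\<forall>u v. \<forall>x y. ?S (?c x y) (u, v)
        - tens2 ?I (Rm ?c y) (?S x) (u, v)
        - tens2 ?I (Lm ?c x) (?S y) (u, v)
        - tens2 (Lm ?o x) ?I (?S y) (u, v)
        + tens2 (Lm ?o y) ?I (?E x) (u, v) = 0) \<and>
    (\<forall>u v. \<forall>x y. tens2 ?I (Rm ?c y) (?Q x) (u, v)
        - tens2 (Rm ?p x) ?I (?S y) (u, v) = 0)"
    unfolding LD_bialgebra_def Let_def comult_sc_add tau_comult_sc circ_mult_sc odot_mult_sc
      LD_coalgebra_comult_sc fun_eq_iff[where 'a = "'i \<times> 'i"] split_paired_All[where 'a = 'i and 'b = 'i]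
    unfolding all_conj_distrib by (intro arg_cong2[where f = "(\<and>)"] refl; blast)
  also have "\<dots> \<longleftrightarrow> LD_sc s p \<and> LDco_sc S P \<and> LDbi_sc s p S P"
    unfolding 1 2 3 4 5 6 LD_algebra_mult_sc LDbi_sc_def all_conj_distrib
    by (intro arg_cong2[where f = "(\<and>)"] refl; blast)
  finally show ?thesis .
qed

subsection \<open>Leibniz algebras with a polarized symmetric form\<close>

text \<open>
  The form is given on basis vectors by B(e_i, e_j) = 1 if j = \<open>\<sigma> i\<close> and 0 otherwise, and the constants
  \<open>m i j k\<close> are B(e_i \<circ> e_j, e_k), so that the coefficient of e_l in e_i \<circ> e_j is \<open>m i j (\<sigma> l)\<close>.
  The predicate \<open>h\<close> selects the basis vectors of A.
\<close>

locale polarized_leibniz =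
  fixes \<sigma> :: "'d::finite \<Rightarrow> 'd" and h :: "'d \<Rightarrow> bool" and m :: "'d \<Rightarrow> 'd \<Rightarrow> 'd \<Rightarrow> 'k::comm_ring_1"
  assumes invol [simp]: "\<sigma> (\<sigma> i) = i"
    and h_invol [simp]: "h (\<sigma> i) \<longleftrightarrow> \<not> h i"
    and cyc: "m v u x + m v x u = m x u v + m u x v"
    and leibniz: "(\<Sum>e\<in>UNIV. m x y (\<sigma> e) * m e z w - m y z (\<sigma> e) * m x e w + m x z (\<sigma> e) * m y e w) = 0"
    and isotropic: "h u = h v \<Longrightarrow> h v = h w \<Longrightarrow> m u v w = 0"
begin

definition lsucc :: "'d \<Rightarrow> 'd \<Rightarrow> 'd \<Rightarrow> 'k" where
  "lsucc i j l = - m i (\<sigma> l) j"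

definition lprec :: "'d \<Rightarrow> 'd \<Rightarrow> 'd \<Rightarrow> 'k" where
  "lprec i j l = m i j (\<sigma> l) + m i (\<sigma> l) j"

definition eps :: "'d \<Rightarrow> 'd \<Rightarrow> 'k" where
  "eps u v = (if h u \<noteq> h v then 0 else if h u then 1 else - 1)"

definition lcosucc :: "'d \<Rightarrow> 'd \<Rightarrow> 'd \<Rightarrow> 'k" where
  "lcosucc x u v = - eps u v * m (\<sigma> u) x (\<sigma> v)"

definition lcoprec :: "'d \<Rightarrow> 'd \<Rightarrow> 'd \<Rightarrow> 'k" where
  "lcoprec x u v = eps u v * (m (\<sigma> u) (\<sigma> v) x + m (\<sigma> u) x (\<sigma> v))"

lemma first_slot: "m e i j = m j e i + m j i e - m i e j"
  using cyc[of j e i] by (simp add: algebra_simps)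

lemma isotropic_sides:
  "h u \<Longrightarrow> h v \<Longrightarrow> h w \<Longrightarrow> m u v w = 0"
  "\<not> h u \<Longrightarrow> \<not> h v \<Longrightarrow> \<not> h w \<Longrightarrow> m u v w = 0"
  by (simp_all add: isotropic)

text \<open>
  Symmetrizing the summand under \<open>\<sigma>\<close> turns identities between contractions into polynomial identities
  in the summands.
\<close>
lemma sum_fold:
  fixes f :: "'d \<Rightarrow> 'k"
  assumes "\<And>e. h e \<Longrightarrow> f e + f (\<sigma> e) = 0"
  shows "(\<Sum>e\<in>UNIV. f e) = 0"
proof -
  have "(\<Sum>e\<in>UNIV. f e) = (\<Sum>e\<in>{e. h e}. f e) + (\<Sum>e\<in>{e. \<not> h e}. f e)"
    by (subst sum.union_disjoint[symmetric]) (auto intro: sum.cong)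
  also have "(\<Sum>e\<in>{e. \<not> h e}. f e) = (\<Sum>e\<in>{e. h e}. f (\<sigma> e))"
    by (rule sum.reindex_bij_witness[of _ \<sigma> \<sigma>]) auto
  finally show ?thesis
    by (simp add: sum.distrib[symmetric] assms)
qed

definition leib :: "'d \<Rightarrow> 'd \<Rightarrow> 'd \<Rightarrow> 'd \<Rightarrow> 'd \<Rightarrow> 'k" where
  "leib x y z w e = m x y (\<sigma> e) * m e z w - m y z (\<sigma> e) * m x e w + m x z (\<sigma> e) * m y e w"

lemma sum_leib: "(\<Sum>e\<in>UNIV. leib x y z w e) = 0"
  unfolding leib_def by (rule leibniz)

lemma LD_sc_lsucc_lprec: "LD_sc lsucc lprec"
  unfolding LD_sc_def
proof (intro allI conjI)
  fix x y z w
  have "ld_ax1 lsucc lprec x y z w +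
      (\<Sum>e\<in>UNIV. leib x y (\<sigma> w) z e) = 0"
    unfolding ld_ax1_def sum.distrib[symmetric]
  proof (rule sum_fold, goal_cases)
    case (1 e)
    then show ?case
      by (simp add: lsucc_def lprec_def leib_def first_slot[of e]
        first_slot[of "\<sigma> e"] algebra_simps)
  qed
  then show "ld_ax1 lsucc lprec x y z w = 0"
    by (simp add: sum.distrib sum_subtractf sum_negf sum_leib)
  have "ld_ax2 lsucc lprec x y z w +
      (\<Sum>e\<in>UNIV. - leib x (\<sigma> w) z y e - leib x z (\<sigma> w) y e) = 0"
    unfolding ld_ax2_def sum.distrib[symmetric]
  proof (rule sum_fold, goal_cases)
    case (1 e)
    then show ?case
      by (simp add: lsucc_def lprec_def leib_def first_slot[of e]
        first_slot[of "\<sigma> e"] algebra_simps)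
  qed
  then show "ld_ax2 lsucc lprec x y z w = 0"
    by (simp add: sum.distrib sum_subtractf sum_negf sum_leib)
  have "ld_ax3 lsucc lprec x y z w +
      (\<Sum>e\<in>UNIV. leib x y z (\<sigma> w) e - leib x (\<sigma> w) z y e + leib x y (\<sigma> w) z e - leib x z (\<sigma> w) y e) = 0"
    unfolding ld_ax3_def sum.distrib[symmetric]
  proof (rule sum_fold, goal_cases)
    case (1 e)
    then show ?case
      by (simp add: lsucc_def lprec_def leib_def first_slot[of e]
        first_slot[of "\<sigma> e"] algebra_simps)
  qed
  then show "ld_ax3 lsucc lprec x y z w = 0"
    by (simp add: sum.distrib sum_subtractf sum_negf sum_leib)
qed

lemma LDco_sc_lcosucc_lcoprec: "LDco_sc lcosucc lcoprec"
  unfolding LDco_sc_def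
proof (intro allI conjI)
  fix x i j l
  have "co_ax1 lcosucc lcoprec x i j l +
      (\<Sum>e\<in>UNIV. (if h i = h j \<and> h j = h l then 1 else 0) * leib (\<sigma> i) (\<sigma> j) x (\<sigma> l) e) = 0"
    unfolding co_ax1_def sum.distrib[symmetric]
  proof (rule sum_fold, goal_cases)
    case (1 e)
    then show ?case
      by (cases "h i"; cases "h j"; cases "h l")
        (simp_all add: lcosucc_def lcoprec_def eps_def leib_def isotropic_sides first_slot[of e]
        first_slot[of "\<sigma> e"] algebra_simps)
  qed
  then show "co_ax1 lcosucc lcoprec x i j l = 0"
    by (simp add: sum.distrib sum_subtractf sum_negf sum_leib sum_distrib_left[symmetric])
  have "co_ax2 lcosucc lcoprec x i j l +
      (\<Sum>e\<in>UNIV. (if h i = h j \<and> h j = h l then 1 else 0) *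
        (leib (\<sigma> i) x (\<sigma> l) (\<sigma> j) e + leib (\<sigma> i) (\<sigma> l) x (\<sigma> j) e)) = 0"
    unfolding co_ax2_def sum.distrib[symmetric]
  proof (rule sum_fold, goal_cases)
    case (1 e)
    then show ?case
      by (cases "h i"; cases "h j"; cases "h l")
        (simp_all add: lcosucc_def lcoprec_def eps_def leib_def isotropic_sides first_slot[of e]
        first_slot[of "\<sigma> e"] algebra_simps)
  qed
  then show "co_ax2 lcosucc lcoprec x i j l = 0"
    by (simp add: sum.distrib sum_subtractf sum_negf sum_leib sum_distrib_left[symmetric])
  have "co_ax3 lcosucc lcoprec x i j l +
      (\<Sum>e\<in>UNIV. (if h i = h j \<and> h j = h l then 1 else 0) *
        (leib (\<sigma> i) (\<sigma> j) (\<sigma> l) x e - leib (\<sigma> i) x (\<sigma> l) (\<sigma> j) e + leib (\<sigma> i) (\<sigma> j) x (\<sigma> l) e - leib (\<sigma> i) (\<sigma> l) x (\<sigma> j) e)) = 0"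
    unfolding co_ax3_def sum.distrib[symmetric]
  proof (rule sum_fold, goal_cases)
    case (1 e)
    then show ?case
      by (cases "h i"; cases "h j"; cases "h l")
        (simp_all add: lcosucc_def lcoprec_def eps_def leib_def isotropic_sides first_slot[of e]
        first_slot[of "\<sigma> e"] algebra_simps)
  qed
  then show "co_ax3 lcosucc lcoprec x i j l = 0"
    by (simp add: sum.distrib sum_subtractf sum_negf sum_leib sum_distrib_left[symmetric])
qed

lemma LDbi_sc_polarized: "LDbi_sc lsucc lprec lcosucc lcoprec"
  unfolding LDbi_sc_def
proof (intro allI conjI)
  fix x y u v
  have "bi_ax1 lsucc lprec lcosucc lcoprec x y u v +
      (\<Sum>e\<in>UNIV. - eps u v * leib (\<sigma> u) (\<sigma> v) x y e) = 0"
    unfolding bi_ax1_def sum.distrib[symmetric]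
  proof (rule sum_fold, goal_cases)
    case (1 e)
    then show ?case
      by (cases "h u"; cases "h v")
        (simp_all add: lsucc_def lprec_def lcosucc_def lcoprec_def eps_def leib_def first_slot[of e]
        first_slot[of "\<sigma> e"] algebra_simps)
  qed
  then show "bi_ax1 lsucc lprec lcosucc lcoprec x y u v = 0"
    by (simp add: sum.distrib sum_subtractf sum_negf sum_leib sum_distrib_left[symmetric])
  have "bi_ax2 lsucc lprec lcosucc lcoprec x y u v +
      (\<Sum>e\<in>UNIV. - eps u v * leib x (\<sigma> u) (\<sigma> v) y e) = 0"
    unfolding bi_ax2_def sum.distrib[symmetric]
  proof (rule sum_fold, goal_cases)
    case (1 e)
    then show ?case
      by (cases "h u"; cases "h v")
        (simp_all add: lsucc_def lprec_def lcosucc_def lcoprec_def eps_def leib_def first_slot[of e]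
        first_slot[of "\<sigma> e"] algebra_simps)
  qed
  then show "bi_ax2 lsucc lprec lcosucc lcoprec x y u v = 0"
    by (simp add: sum.distrib sum_subtractf sum_negf sum_leib sum_distrib_left[symmetric])
  have "bi_ax3 lsucc lprec lcosucc lcoprec x y u v +
      (\<Sum>e\<in>UNIV. eps u v * (leib (\<sigma> u) x (\<sigma> v) y e + leib x (\<sigma> u) (\<sigma> v) y e)) = 0"
    unfolding bi_ax3_def sum.distrib[symmetric]
  proof (rule sum_fold, goal_cases)
    case (1 e)
    then show ?case
      by (cases "h u"; cases "h v")
        (simp_all add: lsucc_def lprec_def lcosucc_def lcoprec_def eps_def leib_def first_slot[of e]
        first_slot[of "\<sigma> e"] algebra_simps)
  qed
  then show "bi_ax3 lsucc lprec lcosucc lcoprec x y u v = 0"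
    by (simp add: sum.distrib sum_subtractf sum_negf sum_leib sum_distrib_left[symmetric])
  have "bi_ax4 lsucc lprec lcosucc lcoprec x y u v +
      (\<Sum>e\<in>UNIV. - eps u v * leib x y (\<sigma> u) (\<sigma> v) e) = 0"
    unfolding bi_ax4_def sum.distrib[symmetric]
  proof (rule sum_fold, goal_cases)
    case (1 e)
    then show ?case
      by (cases "h u"; cases "h v")
        (simp_all add: lsucc_def lprec_def lcosucc_def lcoprec_def eps_def leib_def first_slot[of e]
        first_slot[of "\<sigma> e"] algebra_simps)
  qed
  then show "bi_ax4 lsucc lprec lcosucc lcoprec x y u v = 0"
    by (simp add: sum.distrib sum_subtractf sum_negf sum_leib sum_distrib_left[symmetric])
  have "bi_ax5 lsucc lprec lcosucc lcoprec x y u v +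
      (\<Sum>e\<in>UNIV. - eps u v * leib (\<sigma> u) x y (\<sigma> v) e) = 0"
    unfolding bi_ax5_def sum.distrib[symmetric]
  proof (rule sum_fold, goal_cases)
    case (1 e)
    then show ?case
      by (cases "h u"; cases "h v")
        (simp_all add: lsucc_def lprec_def lcosucc_def lcoprec_def eps_def leib_def first_slot[of e]
        first_slot[of "\<sigma> e"] algebra_simps)
  qed
  then show "bi_ax5 lsucc lprec lcosucc lcoprec x y u v = 0"
    by (simp add: sum.distrib sum_subtractf sum_negf sum_leib sum_distrib_left[symmetric])
  have "bi_ax6 lsucc lprec lcosucc lcoprec x y u v +
      (\<Sum>e\<in>UNIV. - eps u v * (leib x (\<sigma> u) y (\<sigma> v) e + leib (\<sigma> u) x y (\<sigma> v) e)) = 0"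
    unfolding bi_ax6_def sum.distrib[symmetric]
  proof (rule sum_fold, goal_cases)
    case (1 e)
    then show ?case
      by (cases "h u"; cases "h v")
        (simp_all add: lsucc_def lprec_def lcosucc_def lcoprec_def eps_def leib_def first_slot[of e]
        first_slot[of "\<sigma> e"] algebra_simps)
  qed
  then show "bi_ax6 lsucc lprec lcosucc lcoprec x y u v = 0"
    by (simp add: sum.distrib sum_subtractf sum_negf sum_leib sum_distrib_left[symmetric])
qed

subsection \<open>The tensor of the polarization\<close>

definition rpol :: "'d \<times> 'd \<Rightarrow> 'k" where
  "rpol q = (if snd q = \<sigma> (fst q) \<and> h (fst q) then 1 else 0)"

lemma eq_invol_iff: "v = \<sigma> a \<longleftrightarrow> a = \<sigma> v"
  by (metis invol)

lemma sum_rpol: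
  fixes f :: "'d \<Rightarrow> 'k"
  shows "(\<Sum>b\<in>UNIV. f b * rpol (a, b)) = (if h a then f (\<sigma> a) else 0)"
    "(\<Sum>b\<in>UNIV. f b * rpol (b, a)) = (if h a then 0 else f (\<sigma> a))"
proof -
  have "(\<Sum>b\<in>UNIV. f b * rpol (b, a)) = (\<Sum>b\<in>UNIV. if b = \<sigma> a then (if h a then 0 else f (\<sigma> a)) else 0)"
    by (rule sum.cong) (auto simp: rpol_def eq_invol_iff[of a])
  then show "(\<Sum>b\<in>UNIV. f b * rpol (b, a)) = (if h a then 0 else f (\<sigma> a))"
    by simp
  have "(\<Sum>b\<in>UNIV. f b * rpol (a, b)) = (\<Sum>b\<in>UNIV. if b = \<sigma> a then (if h a then f (\<sigma> a) else 0) else 0)"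
    by (rule sum.cong) (auto simp: rpol_def)
  then show "(\<Sum>b\<in>UNIV. f b * rpol (a, b)) = (if h a then f (\<sigma> a) else 0)"
    by simp
qed

lemma rpol_add_tau: "rpol (a, b) + tau rpol (a, b) = (if b = \<sigma> a then 1 else 0)"
  by (auto simp: rpol_def tau_def eq_invol_iff[of a])

lemma sum_rpol_add_tau:
  fixes f :: "'d \<Rightarrow> 'k"
  shows "(\<Sum>b\<in>UNIV. f b * (if b = \<sigma> a then 1 else 0)) = f (\<sigma> a)"
    "(\<Sum>b\<in>UNIV. f b * (if a = \<sigma> b then 1 else 0)) = f (\<sigma> a)"
  by (simp_all add: eq_invol_iff[of a] if_distrib[of "\<lambda>z. _ * z"] cong: if_cong)

lemma circ_lsucc_lprec: "circ (mult_sc lsucc) (mult_sc lprec) = mult_sc (\<lambda>i j l. m i j (\<sigma> l))"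
  by (simp add: circ_mult_sc lsucc_def lprec_def)

lemma odot_lsucc_lprec: "odot (mult_sc lsucc) (mult_sc lprec) = mult_sc (\<lambda>i j l. m (\<sigma> l) i j)"
proof -
  have "lsucc i j l + lprec j i l = m (\<sigma> l) i j" for i j l
    by (simp add: lsucc_def lprec_def first_slot[of "\<sigma> l"])
  then show ?thesis by (simp add: odot_mult_sc)
qed

lemma starop_lsucc_lprec: "starop (mult_sc lsucc) (mult_sc lprec) = mult_sc (\<lambda>i j l. m (\<sigma> l) i j + m (\<sigma> l) j i)"
proof -
  have "lsucc i j l + lprec i j l + (lsucc j i l + lprec j i l) = m (\<sigma> l) i j + m (\<sigma> l) j i" for i j l
    by (simp add: lsucc_def lprec_def first_slot[of "\<sigma> l"])
  then show ?thesis by (simp add: starop_mult_sc)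
qed

lemma cob_succ_rpol: "cob_succ (mult_sc lsucc) (mult_sc lprec) rpol = comult_sc lcosucc"
proof -
  have "cob_succ (mult_sc lsucc) (mult_sc lprec) rpol x (u, v) = comult_sc lcosucc x (u, v)" for x u v
    by (simp add: cob_succ_def odot_lsucc_lprec circ_lsucc_lprec Lm_def Rm_def sum_rpol mult_sc_bv_right mult_sc_bv_left)
      (auto simp: comult_sc_def lcosucc_def eps_def sum_negf)
  then show ?thesis by (auto simp: fun_eq_iff)
qed

lemma cob_prec_rpol: "cob_prec (mult_sc lsucc) (mult_sc lprec) rpol = comult_sc lcoprec"
proof -
  have "cob_prec (mult_sc lsucc) (mult_sc lprec) rpol x (u, v) = comult_sc lcoprec x (u, v)" for x u v
    by (simp add: cob_prec_def starop_lsucc_lprec tau_def Lm_def Rm_def sum_rpol mult_sc_bv_right mult_sc_bv_left)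
      (auto simp: comult_sc_def lcoprec_def lprec_def eps_def sum_negf sum.distrib sum_subtractf algebra_simps)
  then show ?thesis by (auto simp: fun_eq_iff)
qed

lemma invariant_rpol: "invariant_LD (mult_sc lsucc) (mult_sc lprec) (\<lambda>q. rpol q + tau rpol q)"
proof -
  have t: "tau (\<lambda>q. rpol q + tau rpol q) = (\<lambda>q. rpol q + tau rpol q)"
    by (auto simp: fun_eq_iff tau_def)
  show ?thesis
    unfolding invariant_LD_def t fun_eq_iff split_paired_All
    by (simp add: odot_lsucc_lprec circ_lsucc_lprec starop_lsucc_lprec Lm_def Rm_def rpol_add_tau sum_rpol_add_tau mult_sc_bv_right
       mult_sc_bv_left) (simp add: lprec_def algebra_simps)
qed

lemma bij_T_map_rpol: "bij (T_map (\<lambda>q. rpol q + tau rpol q))"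
proof -
  have "T_map (\<lambda>q. rpol q + tau rpol q) \<zeta> = (\<lambda>b. \<zeta> (\<sigma> b))" for \<zeta>
    by (simp add: T_map_def rpol_add_tau sum_rpol_add_tau mult.commute[of _ "\<zeta> _"])
  then show ?thesis
    by (intro o_bij[of "T_map (\<lambda>q. rpol q + tau rpol q)"]) (auto simp: fun_eq_iff)
qed

lemma S_LD_rpol: "S_LD (mult_sc lsucc) (mult_sc lprec) rpol = (\<lambda>w. 0)"
proof -
  have bv_invol: "bv (\<sigma> a) b = (bv a (\<sigma> b) :: 'k)" for a b
    using eq_invol_iff[of b a] by (auto simp: bv_def)
  have "S_LD (mult_sc lsucc) (mult_sc lprec) rpol (i, j, l) = 0" for i j l
  proof -
    define F where "F a b c d = bv a i * bv c j * circ (mult_sc lsucc) (mult_sc lprec) (bv d) (bv b) l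
        - bv a i * odot (mult_sc lsucc) (mult_sc lprec) (bv b) (bv c) j * bv d l
        - mult_sc lsucc (bv a) (bv c) i * bv b j * bv d l" for a b c d
    have "S_LD (mult_sc lsucc) (mult_sc lprec) rpol (i, j, l) =
        (\<Sum>a\<in>UNIV. \<Sum>b\<in>UNIV. (\<Sum>c\<in>UNIV. \<Sum>d\<in>UNIV. F a b c d * rpol (c, d)) * rpol (a, b))"
      by (simp add: S_LD_def F_def tpure3_def sum_distrib_right mult_ac sum_distrib_left)
    also have "\<dots> = (\<Sum>a\<in>UNIV. if h a then \<Sum>c\<in>UNIV. if h c then F a (\<sigma> a) c (\<sigma> c) else 0 else 0)"
      by (simp add: sum_rpol)
    also have "\<dots> = (\<Sum>a\<in>UNIV. \<Sum>c\<in>UNIV. if h a \<and> h c then F a (\<sigma> a) c (\<sigma> c) else 0)"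
      by (intro sum.cong) auto
    also have "\<dots> = (\<Sum>a\<in>UNIV. bv a i * (\<Sum>c\<in>UNIV. bv c j * (if h a \<and> h c then m (\<sigma> c) (\<sigma> a) (\<sigma> l) else 0)))
        - (\<Sum>a\<in>UNIV. bv a i * (\<Sum>c\<in>UNIV. bv c (\<sigma> l) * (if h a \<and> h c then m (\<sigma> j) (\<sigma> a) c else 0)))
        - (\<Sum>a\<in>UNIV. bv a (\<sigma> j) * (\<Sum>c\<in>UNIV. bv c (\<sigma> l) * (if h a \<and> h c then lsucc a c i else 0)))"
      unfolding sum_distrib_left sum_subtractf[symmetric]
      by (intro sum.cong refl) (simp add: F_def circ_lsucc_lprec odot_lsucc_lprec bv_invol algebra_simps)
    also have "\<dots> = 0"
      unfolding sum_bv_left'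
      by (cases "h i"; cases "h j"; cases "h l") (simp_all add: lsucc_def isotropic_sides)
    finally show ?thesis .
  qed
  then show ?thesis by auto
qed

lemma factorizable_rpol: "factorizable_LD (mult_sc lsucc) (mult_sc lprec) rpol"
  unfolding factorizable_LD_def cob_succ_rpol cob_prec_rpol LD_bialgebra_sc
  by (simp add: LD_sc_lsucc_lprec LDco_sc_lcosucc_lcoprec LDbi_sc_polarized S_LD_rpol invariant_rpol bij_T_map_rpol)

end

subsection \<open>The double\<close>

fun swap :: "'n + 'n \<Rightarrow> 'n + 'n" where
  "swap (Inl i) = Inr i"
| "swap (Inr i) = Inl i"

text \<open>
  The constants B(e_i \<circ> e_j, e_k) of the double, where \<open>s\<close>, \<open>p\<close> belong to A and \<open>S l i j\<close>, \<open>P l i j\<close> are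
  the coefficients of e_i \<otimes> e_j in the cooperations of e_l.
\<close>
fun dbl :: "('n, 'k::comm_ring_1) sconst \<Rightarrow> ('n, 'k) sconst \<Rightarrow> ('n, 'k) sconst \<Rightarrow> ('n, 'k) sconst
    \<Rightarrow> ('n + 'n, 'k) sconst" where
  "dbl s p S P (Inl i) (Inl j) (Inl l) = 0"
| "dbl s p S P (Inl i) (Inl j) (Inr l) = s i j l + p i j l"
| "dbl s p S P (Inl i) (Inr j) (Inl l) = - s i l j"
| "dbl s p S P (Inr i) (Inl j) (Inl l) = s j l i + p l j i"
| "dbl s p S P (Inl i) (Inr j) (Inr l) = S i j l + P i l j"
| "dbl s p S P (Inr i) (Inl j) (Inr l) = - S j i l"
| "dbl s p S P (Inr i) (Inr j) (Inl l) = S l i j + P l i j"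
| "dbl s p S P (Inr i) (Inr j) (Inr l) = 0"

lemma sum_UNIV_sum:
  fixes f :: "'a::finite + 'b::finite \<Rightarrow> 'k::comm_ring_1"
  shows "(\<Sum>e\<in>UNIV. f e) = (\<Sum>a\<in>UNIV. f (Inl a)) + (\<Sum>b\<in>UNIV. f (Inr b))"
  using sum.Plus[of UNIV UNIV f] by (simp add: o_def)

lemma dbl_leibniz:
  assumes "LD_sc s p" "LDco_sc S P" "LDbi_sc s p S P"
  shows "(\<Sum>e\<in>UNIV. dbl s p S P x y (swap e) * dbl s p S P e z w - dbl s p S P y z (swap e) * dbl s p S P x e w
     + dbl s p S P x z (swap e) * dbl s p S P y e w) = 0"
    (is "?L x y z w = 0")
proof -
  note b = assms[unfolded LD_sc_def LDco_sc_def LDbi_sc_def, THEN spec, THEN spec, THEN spec, THEN spec]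
  note e = sum_UNIV_sum sum.distrib sum_subtractf sum_negf ld_ax1_def ld_ax2_def ld_ax3_def
    co_ax1_def co_ax2_def co_ax3_def bi_ax1_def bi_ax2_def bi_ax3_def bi_ax4_def bi_ax5_def bi_ax6_def
    algebra_simps
  have LLLR: "?L (Inl x) (Inl y) (Inl z) (Inr w) = - ld_ax3 s p x y z w + ld_ax2 s p x y z w + ld_ax1 s p x y z w" for x y z w
    by (simp add: e)
  have LLRL: "?L (Inl x) (Inl y) (Inr z) (Inl w) = - ld_ax1 s p x y w z" for x y z w
    by (simp add: e)
  have LLRR: "?L (Inl x) (Inl y) (Inr z) (Inr w) = bi_ax4 s p S P x y z w" for x y z w
    by (simp add: e)
  have LRLL: "?L (Inl x) (Inr y) (Inl z) (Inl w) = ld_ax2 s p x w z y + ld_ax1 s p x z w y" for x y z w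
    by (simp add: e)
  have LRLR: "?L (Inl x) (Inr y) (Inl z) (Inr w) = - bi_ax5 s p S P x z y w + bi_ax6 s p S P x z y w" for x y z w
    by (simp add: e)
  have LRRL: "?L (Inl x) (Inr y) (Inr z) (Inl w) = bi_ax2 s p S P x w y z" for x y z w
    by (simp add: e)
  have LRRR: "?L (Inl x) (Inr y) (Inr z) (Inr w) =
    - co_ax3 S P x w z y - co_ax2 S P x z w y + co_ax2 S P x y w z - co_ax1 S P x y z w" for x y z w
    by (simp add: e)
  have RLLL: "?L (Inr x) (Inl y) (Inl z) (Inl w) =
    - ld_ax3 s p w z y x + ld_ax2 s p z w y x - ld_ax2 s p y w z x - ld_ax1 s p y z w x" for x y z w
    by (simp add: e)
  have RLLR: "?L (Inr x) (Inl y) (Inl z) (Inr w) = bi_ax5 s p S P y z x w" for x y z w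
    by (simp add: e)
  have RLRL: "?L (Inr x) (Inl y) (Inr z) (Inl w) = - bi_ax2 s p S P y w x z - bi_ax3 s p S P y w x z" for x y z w
    by (simp add: e)
  have RLRR: "?L (Inr x) (Inl y) (Inr z) (Inr w) = - co_ax2 S P y x w z + co_ax1 S P y x z w" for x y z w
    by (simp add: e)
  have RRLL: "?L (Inr x) (Inr y) (Inl z) (Inl w) = bi_ax1 s p S P z w x y" for x y z w
    by (simp add: e)
  have RRLR: "?L (Inr x) (Inr y) (Inl z) (Inr w) = - co_ax1 S P z x y w" for x y z w
    by (simp add: e)
  have RRRL: "?L (Inr x) (Inr y) (Inr z) (Inl w) = - co_ax3 S P w x y z + co_ax1 S P w x y z - co_ax2 S P w x y z" for x y z w
    by (simp add: e)
  have LLLL: "?L (Inl x) (Inl y) (Inl z) (Inl w) = 0" for x y z w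
    by (simp add: e)
  have RRRR: "?L (Inr x) (Inr y) (Inr z) (Inr w) = 0" for x y z w
    by (simp add: e)
  show ?thesis
    by (cases x; cases y; cases z; cases w)
      (simp_all only: LLLR LLRL LLRR LRLL LRLR LRRL LRRR RLLL RLLR RLRL RLRR RRLL RRLR RRRL LLLL RRRR,
        simp_all add: b)
qed

lemma dual_op_comult_sc: "dual_op (comult_sc c) = mult_sc (\<lambda>i j l. c l i j)"
  for c :: "'i::finite \<Rightarrow> 'i \<Rightarrow> 'i \<Rightarrow> 'k::comm_ring_1"
  by (simp add: fun_eq_iff dual_op_def mult_sc_def)

lemma dualrep_mult_sc:
  fixes f :: "'i::finite \<Rightarrow> 'i \<Rightarrow> 'i \<Rightarrow> 'k::comm_ring_1"
  shows "dualrep (Lm (mult_sc f)) a y = mult_sc (\<lambda>j l i. - f j i l) a y"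
    and "dualrep (Rm (mult_sc f)) a y = mult_sc (\<lambda>j l i. - f i j l) a y"
proof -
  show "dualrep (Lm (mult_sc f)) a y = mult_sc (\<lambda>j l i. - f j i l) a y"
    unfolding mult_sc_def[of _ a y] by (subst sum.swap)
      (simp add: fun_eq_iff dualrep_def Lm_def mult_sc_bv_right sum_negf sum_distrib_left mult_ac)
  show "dualrep (Rm (mult_sc f)) a y = mult_sc (\<lambda>j l i. - f i j l) a y"
    unfolding mult_sc_def[of _ a y] by (subst sum.swap)
      (simp add: fun_eq_iff dualrep_def Rm_def mult_sc_bv_left sum_negf sum_distrib_left mult_ac)
qed

lemma mult_sc_zero [simp]: "mult_sc f (\<lambda>i. 0) y l = 0" "mult_sc f x (\<lambda>i. 0) l = 0"
  by (simp_all add: mult_sc_def)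

lemma bilin_eqI:
  assumes "\<And>y. lin (\<lambda>x. F x y)" "\<And>x. lin (F x)" "\<And>y. lin (\<lambda>x. G x y)" "\<And>x. lin (G x)"
    and "\<And>i j. F (bv i) (bv j) = G (bv i) (bv j)"
  shows "\<forall>x y. F x y = G x y"
  using bilin_zero_iff[of "\<lambda>x y. F x y - G x y"] assms by (simp add: lin_diff)

lemma bv_Inl_Inr [simp]:
  "(\<lambda>i. bv (Inl a) (Inl i)) = bv a" "(\<lambda>i. bv (Inr a) (Inr i)) = bv a"
  "(\<lambda>i. bv (Inl a) (Inr i)) = (\<lambda>i. 0)" "(\<lambda>i. bv (Inr a) (Inl i)) = (\<lambda>i. 0)"
  "bv (Inl a) (Inl j) = bv a j" "bv (Inr a) (Inr j) = bv a j"
  "bv (Inl a) (Inr j) = 0" "bv (Inr a) (Inl j) = 0"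
  by (auto simp: bv_def)

theorem mainTheorem12:
  fixes ms mp cs cp :: "'n::finite \<Rightarrow> 'n \<Rightarrow> 'n \<Rightarrow> 'k::field"
  assumes "LD_bialgebra (mult_sc ms) (mult_sc mp) (comult_sc cs) (comult_sc cp)"
  shows "let sD = double_succ (mult_sc ms) (mult_sc mp) (dual_op (comult_sc cs)) (dual_op (comult_sc cp));
             pD = double_prec (mult_sc ms) (mult_sc mp) (dual_op (comult_sc cs)) (dual_op (comult_sc cp));
             r = (r_can :: ('n + 'n) \<times> ('n + 'n) \<Rightarrow> 'k) in
         S_LD sD pD r = (\<lambda>w. 0) \<and>
         invariant_LD sD pD (\<lambda>q. r q + tau r q) \<and>
         bij (T_map (\<lambda>q. r q + tau r q)) \<and>
         factorizable_LD sD pD r"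
proof -
  interpret D: polarized_leibniz swap isl "dbl ms mp cs cp"
  proof
    show "swap (swap i) = i" for i :: "'n + 'n" by (cases i) simp_all
    show "isl (swap i) \<longleftrightarrow> \<not> isl i" for i :: "'n + 'n" by (cases i) simp_all
    show "dbl ms mp cs cp v u x + dbl ms mp cs cp v x u = dbl ms mp cs cp x u v + dbl ms mp cs cp u x v" for u v x
      by (cases u; cases v; cases x) (simp_all add: algebra_simps)
    show "dbl ms mp cs cp u v w = 0" if "isl u = isl v" "isl v = isl w" for u v w
      using that by (cases u; cases v; cases w) simp_all
  qed (use assms in \<open>simp add: LD_bialgebra_sc dbl_leibniz\<close>)
  have s: "double_succ (mult_sc ms) (mult_sc mp) (dual_op (comult_sc cs)) (dual_op (comult_sc cp)) = mult_sc D.lsucc"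
  proof -
    have "\<forall>x y. double_succ (mult_sc ms) (mult_sc mp) (dual_op (comult_sc cs)) (dual_op (comult_sc cp)) x y w = mult_sc D.lsucc x y w" for w
      unfolding dual_op_comult_sc double_succ_def Let_def circ_mult_sc dualrep_mult_sc
    proof (rule bilin_eqI, goal_cases)
      case (5 i j) then show ?case
        by (cases i; cases j; cases w) (simp_all add: D.lsucc_def)
    qed (cases w; simp only: sum.case mult_sc_def; intro lin_intros)+
    then show ?thesis by blast
  qed
  have p: "double_prec (mult_sc ms) (mult_sc mp) (dual_op (comult_sc cs)) (dual_op (comult_sc cp)) = mult_sc D.lprec"
  proof -
    have "\<forall>x y. double_prec (mult_sc ms) (mult_sc mp) (dual_op (comult_sc cs)) (dual_op (comult_sc cp)) x y w = mult_sc D.lprec x y w" for w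
      unfolding dual_op_comult_sc double_prec_def Let_def circ_mult_sc dualrep_mult_sc
    proof (rule bilin_eqI, goal_cases)
      case (5 i j) then show ?case
        by (cases i; cases j; cases w) (simp_all add: D.lprec_def)
    qed (cases w; simp only: sum.case mult_sc_def; intro lin_intros)+
    then show ?thesis by blast
  qed
  have r: "(r_can :: ('n + 'n) \<times> ('n + 'n) \<Rightarrow> 'k) = D.rpol"
  proof -
    have "r_can (a, b) = D.rpol (a, b)" for a b
      by (cases a; cases b) (simp_all add: r_can_def D.rpol_def tpure_def, simp_all add: bv_def)
    then show ?thesis by auto
  qed
  show ?thesis
    unfolding Let_def s p r
    using D.S_LD_rpol D.invariant_rpol D.bij_T_map_rpol D.factorizable_rpol by blast
qed

end
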